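(* Let $\Phi$ be a finite irreducible crystallographic root system with simple system $\Pi$, let $S\subseteq\Pi$, and let $\beta\in\Phi^+$ with $\mathrm{Supp}(\beta)\cap S\ne\emptyset$. (1) $\Phi_{S,\mathbb Z\beta}$ is a root subsystem of $\Phi$. (2) $\Phi_{S,\beta}$ is an interval of the root poset, i.e. it has a minimum and a maximum and contains every root in between. Moreover, both $$\{\min\Phi_{S,\beta}\}\cup(\Pi\setminus S)\quad\text{and}\quad\{-\max\Phi_{S,\beta}\}\cup(\Pi\setminus S)$$ are simple systems of $\Phi_{S,\mathbb Z\beta}$; in particular, $\min\Phi_{S,\beta}$ and $\max\Phi_{S,\beta}$ have the same length. (3) Let $\Psi=\Phi_{S,\mathbb Z\beta}$ and choose $\{\gamma\}\cup(\Pi\setminus S)$ as a set of simple roots of $\Psi$, where either $\gamma=\min\Phi_{S,\beta}$ or $\gamma=-\max\Phi_{S,\beta}$. Then $\Phi_{S,\beta}=\Psi_{\{\gamma\},\gamma}$ if $\gamma=\min\Phi_{S,\beta}$, and $\Phi_{S,\beta}=-\Psi_{\{\gamma\},\gamma}$ if $\gamma=-\max\Phi_{S,\beta}$.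
   Context: $\Phi$ is reduced, in a Euclidean space $\mathbb E=\mathrm{Span}_{\mathbb R}\Phi$ with Weyl-group-invariant form; $\Phi^+$ is the set of positive roots with respect to $\Pi$. Each root $\gamma$ is written $\gamma=\sum_{\alpha\in\Pi}c_\alpha(\gamma)\alpha$; $\mathrm{Supp}(\gamma)=\{\alpha\in\Pi:c_\alpha(\gamma)\ne0\}$. Define $$\Phi_{S,\beta}=\{\gamma\in\Phi:c_\alpha(\gamma)=c_\alpha(\beta)\ \forall\alpha\in S\},$$ $$\Phi_{S,\mathbb Z\beta}=\{\gamma\in\Phi:\exists k\in\mathbb Z\text{ with }c_\alpha(\gamma)=k\,c_\alpha(\beta)\ \forall\alpha\in S\}.$$ The root poset is $\Phi^+$ with $\alpha\le\beta$ iff $\beta-\alpha$ is a nonnegative linear combination of positive roots. For a root system $\Psi$ with simple system containing $\gamma$, $\Psi_{\{\gamma\},\gamma}$ is defined by the same recipe with respect to that simple system: it is the set of roots of $\Psi$ whose $\gamma$-coordinate is $1$. *)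

theory Defs
  imports "HOL-Analysis.Analysis"
begin

text \<open>
  Root systems live in a Euclidean space whose inner product is the Weyl-invariant form: the
  reflections below are orthogonal for it.  A root system is taken in its own span, so that
  root subsystems are root systems in the same sense; that a root system spans the ambient
  space is a separate assumption.
\<close>

definition root_reflection :: "'a::euclidean_space \<Rightarrow> 'a \<Rightarrow> 'a" where
  "root_reflection \<alpha> x = x - (2 * (x \<bullet> \<alpha>) / (\<alpha> \<bullet> \<alpha>)) *\<^sub>R \<alpha>"

text \<open>Finite, reduced and crystallographic.\<close>

definition root_system :: "'a::euclidean_space set \<Rightarrow> bool" where
  "root_system \<Phi> \<longleftrightarrow>
     finite \<Phi> \<and> 0 \<notin> \<Phi> \<and>
     (\<forall>\<alpha>\<in>\<Phi>. \<forall>\<beta>\<in>\<Phi>. root_reflection \<alpha> \<beta> \<in> \<Phi>) \<and>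
     (\<forall>\<alpha>\<in>\<Phi>. \<forall>\<beta>\<in>\<Phi>. 2 * (\<beta> \<bullet> \<alpha>) / (\<alpha> \<bullet> \<alpha>) \<in> \<int>) \<and>
     (\<forall>\<alpha>\<in>\<Phi>. \<forall>c. c *\<^sub>R \<alpha> \<in> \<Phi> \<longrightarrow> c = 1 \<or> c = - 1)"

definition irreducible_roots :: "'a::euclidean_space set \<Rightarrow> bool" where
  "irreducible_roots \<Phi> \<longleftrightarrow>
     \<Phi> \<noteq> {} \<and>
     \<not> (\<exists>A B. A \<noteq> {} \<and> B \<noteq> {} \<and> A \<union> B = \<Phi> \<and> A \<inter> B = {} \<and> (\<forall>a\<in>A. \<forall>b\<in>B. orthogonal a b))"

definition root_subsystem :: "'a::euclidean_space set \<Rightarrow> 'a set \<Rightarrow> bool" where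
  "root_subsystem \<Psi> \<Phi> \<longleftrightarrow> \<Psi> \<subseteq> \<Phi> \<and> root_system \<Psi>"

text \<open>
  The coordinate of a root \<open>\<gamma>\<close> at the simple root \<open>\<alpha> \<in> \<Delta>\<close> is \<open>representation \<Delta> \<gamma> \<alpha>\<close>.
\<close>

definition simple_system :: "'a::euclidean_space set \<Rightarrow> 'a set \<Rightarrow> bool" where
  "simple_system \<Delta> \<Phi> \<longleftrightarrow>
     \<Delta> \<subseteq> \<Phi> \<and> independent \<Delta> \<and> span \<Delta> = span \<Phi> \<and>
     (\<forall>\<gamma>\<in>\<Phi>. (\<forall>\<alpha>\<in>\<Delta>. representation \<Delta> \<gamma> \<alpha> \<in> \<int>) \<and>
        ((\<forall>\<alpha>\<in>\<Delta>. 0 \<le> representation \<Delta> \<gamma> \<alpha>) \<or> (\<forall>\<alpha>\<in>\<Delta>. representation \<Delta> \<gamma> \<alpha> \<le> 0)))"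

definition positive_roots :: "'a::euclidean_space set \<Rightarrow> 'a set \<Rightarrow> 'a set" where
  "positive_roots \<Phi> \<Delta> = {\<gamma>\<in>\<Phi>. \<forall>\<alpha>\<in>\<Delta>. 0 \<le> representation \<Delta> \<gamma> \<alpha>}"

definition root_support :: "'a::euclidean_space set \<Rightarrow> 'a \<Rightarrow> 'a set" where
  "root_support \<Delta> \<gamma> = {\<alpha>\<in>\<Delta>. representation \<Delta> \<gamma> \<alpha> \<noteq> 0}"

definition same_coord_roots ::
    "'a::euclidean_space set \<Rightarrow> 'a set \<Rightarrow> 'a set \<Rightarrow> 'a \<Rightarrow> 'a set" where
  "same_coord_roots \<Phi> \<Delta> S \<beta> =
     {\<gamma>\<in>\<Phi>. \<forall>\<alpha>\<in>S. representation \<Delta> \<gamma> \<alpha> = representation \<Delta> \<beta> \<alpha>}"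

definition mult_coord_roots ::
    "'a::euclidean_space set \<Rightarrow> 'a set \<Rightarrow> 'a set \<Rightarrow> 'a \<Rightarrow> 'a set" where
  "mult_coord_roots \<Phi> \<Delta> S \<beta> =
     {\<gamma>\<in>\<Phi>. \<exists>k::int. \<forall>\<alpha>\<in>S. representation \<Delta> \<gamma> \<alpha> = of_int k * representation \<Delta> \<beta> \<alpha>}"

text \<open>The order of the root poset, which has carrier \<open>positive_roots \<Phi> \<Delta>\<close>.\<close>

definition root_le :: "'a::euclidean_space set \<Rightarrow> 'a set \<Rightarrow> 'a \<Rightarrow> 'a \<Rightarrow> bool" where
  "root_le \<Phi> \<Delta> x y \<longleftrightarrow>
     (\<exists>c. (\<forall>\<rho>\<in>positive_roots \<Phi> \<Delta>. 0 \<le> c \<rho>) \<and> y - x = (\<Sum>\<rho>\<in>positive_roots \<Phi> \<Delta>. c \<rho> *\<^sub>R \<rho>))"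

definition is_root_min :: "'a::euclidean_space set \<Rightarrow> 'a set \<Rightarrow> 'a set \<Rightarrow> 'a \<Rightarrow> bool" where
  "is_root_min \<Phi> \<Delta> X m \<longleftrightarrow> m \<in> X \<and> (\<forall>x\<in>X. root_le \<Phi> \<Delta> m x)"

definition is_root_max :: "'a::euclidean_space set \<Rightarrow> 'a set \<Rightarrow> 'a set \<Rightarrow> 'a \<Rightarrow> bool" where
  "is_root_max \<Phi> \<Delta> X M \<longleftrightarrow> M \<in> X \<and> (\<forall>x\<in>X. root_le \<Phi> \<Delta> x M)"

end

theory Submission
  imports Defs
begin

text \<open>
  Fix \<open>\<epsilon> = \<plusminus>1\<close> and put \<open>J = \<Delta> - S\<close>.  Every root of \<open>\<Psi>\<close> has a level \<open>k\<close>, the integer with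
  \<open>S\<close>-coordinates \<open>k\<close> times those of \<open>\<beta>\<close>.  Order \<open>\<Psi>\<close> by the functional
  \<open>height + \<epsilon> N level\<close> with \<open>N\<close> large, and let \<open>m\<close> be an element of level \<open>1\<close> for which
  \<open>\<epsilon> height\<close> is least.  Then \<open>\<epsilon> m\<close> and the elements of \<open>J\<close> are indecomposable positive roots
  of \<open>\<Psi>\<close>, and they span it, so they form a simple system.  The value \<open>\<epsilon> = 1\<close> gives the
  minimum, \<open>\<epsilon> = -1\<close> gives the maximum.  Both extremal roots have the greatest norm in
  level \<open>1\<close>, because within its norm class any root of level \<open>1\<close> can be moved by reflections in
  \<open>J\<close> to one that is (anti)dominant for \<open>J\<close>.
\<close>

section \<open>Reflections and differences of roots\<close>

lemma linear_sum_scaleR: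
  assumes "linear f"
  shows "f (\<Sum>b\<in>B. c b *\<^sub>R g b) = (\<Sum>b\<in>B. c b *\<^sub>R f (g b))"
  by (simp add: linear_sum[OF assms] linear_cmul[OF assms])

lemma root_system_reflection:
  "root_system \<Phi> \<Longrightarrow> \<alpha> \<in> \<Phi> \<Longrightarrow> \<gamma> \<in> \<Phi> \<Longrightarrow> root_reflection \<alpha> \<gamma> \<in> \<Phi>"
  by (simp add: root_system_def)

lemma root_system_reduced:
  "root_system \<Phi> \<Longrightarrow> \<alpha> \<in> \<Phi> \<Longrightarrow> c *\<^sub>R \<alpha> \<in> \<Phi> \<Longrightarrow> c = 1 \<or> c = - 1"
  by (auto simp: root_system_def)

lemma root_system_uminus:
  assumes "root_system \<Phi>" "\<alpha> \<in> \<Phi>"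
  shows "- \<alpha> \<in> \<Phi>"
proof -
  have "root_reflection \<alpha> \<alpha> \<in> \<Phi>" "\<alpha> \<noteq> 0"
    using assms by (auto simp: root_system_def)
  then show ?thesis
    by (simp add: root_reflection_def scaleR_2)
qed

lemma Ints_gt_0_ge_1: "(x::real) \<in> \<int> \<Longrightarrow> 0 < x \<Longrightarrow> 1 \<le> x"
  by (auto elim!: Ints_cases)

text \<open>The two Cartan integers \<open>p\<close> and \<open>q\<close> are positive, and
  reducedness excludes parallel \<open>a\<close> and \<open>b\<close>, so strict Cauchy-Schwarz
  gives \<open>p * q < 4\<close>. Hence one of them is 1, and the corresponding reflection yields
  the difference up to sign.\<close>

lemma root_system_diff:
  assumes \<Phi>: "root_system \<Phi>" and ab: "a \<in> \<Phi>" "b \<in> \<Phi>" and pos: "a \<bullet> b > 0" and "a \<noteq> b"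
  shows "a - b \<in> \<Phi>"
proof -
  define p where "p = 2 * (a \<bullet> b) / (b \<bullet> b)"
  define q where "q = 2 * (b \<bullet> a) / (a \<bullet> a)"
  have nz: "a \<noteq> 0" "b \<noteq> 0" using \<Phi> ab by (auto simp: root_system_def)
  have "p \<in> \<int>" "q \<in> \<int>" using \<Phi> ab by (auto simp: root_system_def p_def q_def)
  moreover have "p > 0" "q > 0" using pos nz by (auto simp: p_def q_def inner_commute)
  ultimately have ge: "p \<ge> 1" "q \<ge> 1" by (auto intro: Ints_gt_0_ge_1)
  have "p * q < 4"
  proof -
    have "norm a *\<^sub>R b \<noteq> norm b *\<^sub>R a"
    proof
      assume eq: "norm a *\<^sub>R b = norm b *\<^sub>R a"
      have b: "b = (norm b / norm a) *\<^sub>R a"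
        using arg_cong[OF eq, of "\<lambda>x. inverse (norm a) *\<^sub>R x"] nz by (simp add: divide_inverse_commute)
      then have "norm b / norm a = 1 \<or> norm b / norm a = - 1"
        using root_system_reduced[OF \<Phi> ab(1)] ab(2) by metis
      moreover have "norm b / norm a > 0" using nz by simp
      ultimately have "norm b / norm a = 1" by linarith
      then have "b = 1 *\<^sub>R a" using b by (simp only:)
      then show False using \<open>a \<noteq> b\<close> by simp
    qed
    then have "norm a * norm b \<noteq> a \<bullet> b"
      by (metis norm_cauchy_schwarz_eq)
    then have "a \<bullet> b < norm a * norm b"
      using norm_cauchy_schwarz[of a b] by linarith
    then have "(a \<bullet> b)\<^sup>2 < (norm a * norm b)\<^sup>2"
      using pos by (intro power_strict_mono) auto
    then have "(a \<bullet> b)\<^sup>2 < (a \<bullet> a) * (b \<bullet> b)"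
      by (simp add: power_mult_distrib power2_norm_eq_inner)
    moreover have "a \<bullet> a > 0" "b \<bullet> b > 0" using nz by auto
    moreover have "p * q = 4 * (a \<bullet> b)\<^sup>2 / ((a \<bullet> a) * (b \<bullet> b))"
      by (simp add: p_def q_def inner_commute power2_eq_square)
    ultimately show ?thesis by (simp add: divide_less_eq)
  qed
  have "p = 1 \<or> q = 1"
  proof (rule ccontr)
    assume "\<not> (p = 1 \<or> q = 1)"
    then have "p - 1 > 0" "q - 1 > 0" using ge by auto
    moreover have "p - 1 \<in> \<int>" "q - 1 \<in> \<int>" using \<open>p \<in> \<int>\<close> \<open>q \<in> \<int>\<close> by auto
    ultimately have "p \<ge> 2" "q \<ge> 2" using Ints_gt_0_ge_1 by fastforce+
    then have "2 * 2 \<le> p * q" by (intro mult_mono) auto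
    then show False using \<open>p * q < 4\<close> by simp
  qed
  then show ?thesis
  proof
    assume "p = 1"
    then have "root_reflection b a = a - b" by (simp add: root_reflection_def flip: p_def)
    then show ?thesis using root_system_reflection[OF \<Phi> ab(2,1)] by simp
  next
    assume "q = 1"
    then have "root_reflection a b = b - a" by (simp add: root_reflection_def flip: q_def)
    then have "b - a \<in> \<Phi>" using root_system_reflection[OF \<Phi> ab] by simp
    then show ?thesis using root_system_uminus[OF \<Phi>, of "b - a"] by simp
  qed
qed

section \<open>Simple systems from indecomposable roots\<close>

lemma obtuse_coeffs_nonpos:
  fixes f :: "'a::euclidean_space \<Rightarrow> real"
  assumes fin: "finite B" and f: "linear f" and f_pos: "\<And>b. b \<in> B \<Longrightarrow> f b > 0"
    and obtuse: "\<And>a b. a \<in> B \<Longrightarrow> b \<in> B \<Longrightarrow> a \<noteq> b \<Longrightarrow> a \<bullet> b \<le> 0"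
    and x: "x = (\<Sum>b\<in>B. c b *\<^sub>R b)"
    and x_le: "\<And>b. b \<in> B \<Longrightarrow> x \<bullet> b \<le> 0"
    and "b \<in> B"
  shows "c b \<le> 0"
proof -
  \<comment> \<open>The positive part \<open>p\<close> and the negative part \<open>n\<close> of the
    expansion satisfy \<open>p \<bullet> p = x \<bullet> p + p \<bullet> n\<close>, where both
    summands are nonpositive. So \<open>p = 0\<close>, and applying \<open>f\<close>, which is
    positive on \<open>B\<close>, makes every \<open>u b\<close> vanish.\<close>
  define u where "u = (\<lambda>b. max (c b) 0)"
  define v where "v = (\<lambda>b. max (- c b) 0)"
  define p where "p = (\<Sum>b\<in>B. u b *\<^sub>R b)"
  define n where "n = (\<Sum>b\<in>B. v b *\<^sub>R b)"
  have "c = (\<lambda>b. u b - v b)" by (auto simp: u_def v_def)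
  then have "x = p - n"
    by (simp add: x p_def n_def scaleR_diff_left sum_subtractf)
  then have "p \<bullet> p = x \<bullet> p + p \<bullet> n"
    by (simp add: inner_diff_left inner_diff_right inner_commute)
  moreover have "x \<bullet> p \<le> 0"
    unfolding p_def inner_sum_right inner_scaleR_right
    by (intro sum_nonpos mult_nonneg_nonpos) (auto simp: u_def x_le)
  \<comment> \<open>Diagonal terms vanish since \<open>u b\<close> and \<open>v b\<close> are never
    both nonzero; the others are controlled by obtuseness.\<close>
  moreover have "p \<bullet> n \<le> 0"
    unfolding p_def n_def inner_sum_right inner_sum_left inner_scaleR_right inner_scaleR_left
      sum_distrib_left
  proof (intro sum_nonpos)
    fix a b assume "a \<in> B" "b \<in> B"
    show "v a * (u b * (b \<bullet> a)) \<le> 0"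
    proof (cases "a = b")
      case False
      then show ?thesis using obtuse \<open>a \<in> B\<close> \<open>b \<in> B\<close>
        by (intro mult_nonneg_nonpos) (auto simp: u_def v_def)
    qed (auto simp: u_def v_def max_def)
  qed
  ultimately have "p = 0"
    by (metis add_nonpos_nonpos inner_eq_zero_iff inner_ge_zero order_antisym)
  then have "(\<Sum>b\<in>B. u b * f b) = 0"
    using linear_sum_scaleR[OF f, of u "\<lambda>b. b" B] linear_0[OF f] by (simp add: p_def)
  moreover have "\<And>b. b \<in> B \<Longrightarrow> 0 \<le> u b * f b"
    using f_pos by (simp add: u_def less_imp_le)
  ultimately have "u b * f b = 0"
    using fin \<open>b \<in> B\<close> by (simp add: sum_nonneg_eq_0_iff)
  then show ?thesis using f_pos[OF \<open>b \<in> B\<close>] by (auto simp: u_def max_def split: if_splits)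
qed

text \<open>The functional \<open>f\<close> splits the roots into positive and negative ones.
  Indecomposability makes \<open>B\<close> obtuse, hence independent, and positive roots reduce to
  elements of \<open>B\<close> by subtracting members of \<open>B\<close> one at a time, which gives
  natural coefficients.\<close>

lemma simple_system_indecomposable:
  fixes f :: "'a::euclidean_space \<Rightarrow> real"
  assumes \<Psi>: "root_system \<Psi>" and B: "B \<subseteq> \<Psi>" and span: "\<Psi> \<subseteq> span B"
    and f: "linear f" and f_nz: "\<And>\<gamma>. \<gamma> \<in> \<Psi> \<Longrightarrow> f \<gamma> \<noteq> 0" and f_pos: "\<And>b. b \<in> B \<Longrightarrow> f b > 0"
    and indec: "\<And>b x y. b \<in> B \<Longrightarrow> x \<in> \<Psi> \<Longrightarrow> y \<in> \<Psi> \<Longrightarrow> f x > 0 \<Longrightarrow> f y > 0 \<Longrightarrow> b \<noteq> x + y"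
  shows "simple_system B \<Psi>"
proof -
  have "finite \<Psi>" using \<Psi> by (simp add: root_system_def)
  then have fin: "finite B" using B finite_subset by blast
  have sub_pos: "\<gamma> - b \<in> \<Psi> \<and> f (\<gamma> - b) > 0"
    if "\<gamma> \<in> \<Psi>" "f \<gamma> > 0" "b \<in> B" "\<gamma> \<bullet> b > 0" "\<gamma> \<noteq> b" for \<gamma> b
  proof -
    have d: "\<gamma> - b \<in> \<Psi>" using root_system_diff[OF \<Psi>] that B by blast
    \<comment> \<open>Otherwise \<open>b = \<gamma> + (b - \<gamma>)\<close> would decompose
      \<open>b\<close>.\<close>
    have "\<not> f (\<gamma> - b) < 0"
    proof
      assume "f (\<gamma> - b) < 0"
      then have "f (b - \<gamma>) > 0" by (simp add: linear_diff[OF f])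
      moreover have "b - \<gamma> \<in> \<Psi>" using root_system_uminus[OF \<Psi> d] by simp
      ultimately show False using indec[of b \<gamma> "b - \<gamma>"] that by simp
    qed
    then show ?thesis using d f_nz[OF d] by linarith
  qed
  have obtuse: "a \<bullet> b \<le> 0" if "a \<in> B" "b \<in> B" "a \<noteq> b" for a b
  proof (rule ccontr)
    assume "\<not> a \<bullet> b \<le> 0"
    then have "a - b \<in> \<Psi> \<and> f (a - b) > 0" using that B f_pos by (intro sub_pos) auto
    then show False using indec[of a "a - b" b] that B f_pos by auto
  qed
  have ind: "independent B"
  proof
    assume "dependent B"
    then obtain c b where c: "(\<Sum>b\<in>B. c b *\<^sub>R b) = 0" and b: "b \<in> B" "c b \<noteq> 0"
      using dependent_finite[OF fin] by blast
    \<comment> \<open>Both \<open>c\<close> and its negative are coefficient families of the vector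
      0.\<close>
    have "c b \<le> 0"
      using obtuse_coeffs_nonpos[OF fin f f_pos obtuse, where x=0 and c=c and b=b] c b by simp
    moreover have "- c b \<le> 0"
      using obtuse_coeffs_nonpos[OF fin f f_pos obtuse, where x=0 and c="\<lambda>b. - c b" and b=b] c b
      by (simp add: sum_negf)
    ultimately show False using b by simp
  qed
  have nat: "\<forall>b\<in>B. representation B \<gamma> b \<in> \<nat>" if "\<gamma> \<in> \<Psi>" "f \<gamma> > 0" for \<gamma>
    using that
  \<comment> \<open>The values of \<open>f\<close> are real, so the induction runs over the number
    of roots with a smaller value.\<close>
  proof (induction "card {\<delta>\<in>\<Psi>. f \<delta> < f \<gamma>}" arbitrary: \<gamma> rule: less_induct)
    case less
    show ?case
    proof (cases "\<gamma> \<in> B")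
      case True
      then show ?thesis by (simp add: representation_basis[OF ind])
    next
      case False
      have \<gamma>: "\<gamma> = (\<Sum>b\<in>B. representation B \<gamma> b *\<^sub>R b)"
        using sum_representation_eq[OF ind _ fin order_refl, of \<gamma>] span less.prems by auto
      \<comment> \<open>Otherwise all coefficients of \<open>\<gamma>\<close> would be nonpositive,
        contradicting \<open>f \<gamma> > 0\<close>.\<close>
      have "\<exists>b\<in>B. \<gamma> \<bullet> b > 0"
      proof (rule ccontr)
        assume "\<not> ?thesis"
        then have "representation B \<gamma> b \<le> 0" if "b \<in> B" for b
          using obtuse_coeffs_nonpos[OF fin f f_pos obtuse \<gamma> _ that] by (auto simp: not_less)
        then have "(\<Sum>b\<in>B. representation B \<gamma> b * f b) \<le> 0"
          using f_pos by (intro sum_nonpos mult_nonpos_nonneg) (auto simp: less_imp_le)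
        moreover have "f \<gamma> = (\<Sum>b\<in>B. representation B \<gamma> b * f b)"
          using arg_cong[OF \<gamma>, of f] linear_sum_scaleR[OF f] by simp
        ultimately show False using less.prems by simp
      qed
      then obtain b where b: "b \<in> B" "\<gamma> \<bullet> b > 0" by blast
      then have d: "\<gamma> - b \<in> \<Psi>" "f (\<gamma> - b) > 0" using sub_pos False less.prems by blast+
      have "f (\<gamma> - b) < f \<gamma>" using f_pos[OF b(1)] by (simp add: linear_diff[OF f])
      then have "{\<delta>\<in>\<Psi>. f \<delta> < f (\<gamma> - b)} \<subset> {\<delta>\<in>\<Psi>. f \<delta> < f \<gamma>}" using d by auto
      then have "card {\<delta>\<in>\<Psi>. f \<delta> < f (\<gamma> - b)} < card {\<delta>\<in>\<Psi>. f \<delta> < f \<gamma>}"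
        using \<open>finite \<Psi>\<close> by (intro psubset_card_mono) auto
      then have IH: "\<forall>a\<in>B. representation B (\<gamma> - b) a \<in> \<nat>" using less.hyps d by blast
      have "representation B \<gamma> = (\<lambda>a. representation B (\<gamma> - b) a + representation B b a)"
        using representation_add[OF ind, of b "\<gamma> - b"] span d b span_base[of b B]
        by (auto simp: subset_iff)
      then show ?thesis using IH b by (simp add: representation_basis[OF ind])
    qed
  qed
  have "(\<forall>b\<in>B. representation B \<gamma> b \<in> \<int>) \<and>
      ((\<forall>b\<in>B. 0 \<le> representation B \<gamma> b) \<or> (\<forall>b\<in>B. representation B \<gamma> b \<le> 0))"
    if \<gamma>: "\<gamma> \<in> \<Psi>" for \<gamma>
  proof (cases "f \<gamma> > 0")
    case True
    then have "representation B \<gamma> b \<in> \<nat>" if "b \<in> B" for b using nat[OF \<gamma>] that by blast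
    then have "representation B \<gamma> b \<in> \<int> \<and> 0 \<le> representation B \<gamma> b" if "b \<in> B" for b
      using that by (metis Nats_cases of_nat_0_le_iff Ints_of_nat)
    then show ?thesis by blast
  next
    case False
    then have "f (- \<gamma>) > 0" using f_nz[OF \<gamma>] by (simp add: linear_neg[OF f])
    then have *: "\<forall>b\<in>B. representation B (- \<gamma>) b \<in> \<nat>"
      using nat root_system_uminus[OF \<Psi> \<gamma>] by blast
    have neg: "representation B (- \<gamma>) = (\<lambda>b. - representation B \<gamma> b)"
      using representation_neg[OF ind] span \<gamma> by blast
    have "representation B \<gamma> b \<in> \<int> \<and> representation B \<gamma> b \<le> 0" if "b \<in> B" for b
    proof -
      have "- representation B \<gamma> b \<in> \<nat>" using * that by (simp add: neg)
      then obtain n where "- representation B \<gamma> b = of_nat n" by (rule Nats_cases)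
      then have "representation B \<gamma> b = - of_nat n" by simp
      then show ?thesis by simp
    qed
    then show ?thesis by blast
  qed
  moreover have "span B = span \<Psi>"
    using B span by (metis span_mono span_span subset_antisym)
  ultimately show ?thesis using B ind by (simp add: simple_system_def)
qed

section \<open>Coordinates, height and level on a slice\<close>

locale coordinate_slice =
  fixes \<Phi> \<Delta> S :: "'a::euclidean_space set" and \<beta> s :: 'a
  assumes root_system: "root_system \<Phi>" and span_roots: "span \<Phi> = UNIV"
    and simple: "simple_system \<Delta> \<Phi>" and S_subset: "S \<subseteq> \<Delta>"
    and \<beta>_root: "\<beta> \<in> \<Phi>" and s_in: "s \<in> S" and s_pos: "representation \<Delta> \<beta> s > 0"
begin

abbreviation "coord x \<alpha> \<equiv> representation \<Delta> x \<alpha>"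
abbreviation "\<Psi> \<equiv> mult_coord_roots \<Phi> \<Delta> S \<beta>"
abbreviation "X \<equiv> same_coord_roots \<Phi> \<Delta> S \<beta>"
abbreviation "J \<equiv> \<Delta> - S"

definition "height x = (\<Sum>\<alpha>\<in>\<Delta>. coord x \<alpha>)"
text \<open>Reading the multiple off at one fixed \<open>s\<close> turns the integer
  \<open>k\<close> of \<open>mult_coord_roots\<close> into a linear functional on the whole
  space.\<close>

definition "level x = coord x s / coord \<beta> s"

lemma finite_roots: "finite \<Phi>" and roots_nz: "0 \<notin> \<Phi>"
  using root_system by (auto simp: root_system_def)

lemma \<Delta>_subset: "\<Delta> \<subseteq> \<Phi>" and indep: "independent \<Delta>" and span_\<Delta>: "span \<Delta> = UNIV"
  using simple span_roots by (auto simp: simple_system_def)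

lemma finite_\<Delta>: "finite \<Delta>"
  using finite_roots \<Delta>_subset finite_subset by blast

lemma s_simple: "s \<in> \<Delta>"
  using s_in S_subset by blast

lemma linear_coord: "linear (\<lambda>x. coord x \<alpha>)"
  using representation_add[OF indep] representation_scale[OF indep]
  by (intro linearI) (simp_all add: span_\<Delta>)

lemmas coord_simps =
  linear_add[OF linear_coord] linear_diff[OF linear_coord] linear_neg[OF linear_coord]
  linear_cmul[OF linear_coord] linear_0[OF linear_coord]

lemma linear_level: "linear level"
  unfolding level_def by (intro linearI) (simp_all add: coord_simps add_divide_distrib)

lemma linear_height: "linear height"
  unfolding height_def
  by (intro linearI) (simp_all add: coord_simps sum.distrib sum_distrib_left)

lemmas level_simps =
  linear_add[OF linear_level] linear_diff[OF linear_level] linear_neg[OF linear_level]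
  linear_cmul[OF linear_level]
lemmas height_simps =
  linear_add[OF linear_height] linear_diff[OF linear_height] linear_neg[OF linear_height]
  linear_cmul[OF linear_height]

lemma coord_simple: "\<alpha> \<in> \<Delta> \<Longrightarrow> coord \<alpha> \<gamma> = (if \<gamma> = \<alpha> then 1 else 0)"
  by (simp add: representation_basis[OF indep])

lemma coord_sum: "(\<Sum>\<alpha>\<in>\<Delta>. coord x \<alpha> *\<^sub>R \<alpha>) = x"
  using sum_representation_eq[OF indep _ finite_\<Delta> order_refl, of x] by (simp add: span_\<Delta>)

lemma coord_Ints: "\<gamma> \<in> \<Phi> \<Longrightarrow> \<alpha> \<in> \<Delta> \<Longrightarrow> coord \<gamma> \<alpha> \<in> \<int>"
  using simple by (auto simp: simple_system_def)

lemma coord_signs: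
  "\<gamma> \<in> \<Phi> \<Longrightarrow> (\<forall>\<alpha>\<in>\<Delta>. 0 \<le> coord \<gamma> \<alpha>) \<or> (\<forall>\<alpha>\<in>\<Delta>. coord \<gamma> \<alpha> \<le> 0)"
  using simple by (auto simp: simple_system_def)

lemma height_Ints: "\<gamma> \<in> \<Phi> \<Longrightarrow> height \<gamma> \<in> \<int>"
  unfolding height_def by (intro Ints_sum coord_Ints)

lemma height_simple: "\<alpha> \<in> \<Delta> \<Longrightarrow> height \<alpha> = 1"
  unfolding height_def using finite_\<Delta> by (simp add: coord_simple sum.delta)

text \<open>Coordinates of one sign that sum to zero all vanish, and 0 is not a root.\<close>

lemma height_nz:
  assumes "\<gamma> \<in> \<Phi>"
  shows "height \<gamma> \<noteq> 0"
proof
  assume 0: "height \<gamma> = 0"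
  then have neg: "(\<Sum>\<alpha>\<in>\<Delta>. - coord \<gamma> \<alpha>) = 0" by (simp add: height_def sum_negf)
  have "\<forall>\<alpha>\<in>\<Delta>. coord \<gamma> \<alpha> = 0"
    using coord_signs[OF assms]
  proof
    assume "\<forall>\<alpha>\<in>\<Delta>. 0 \<le> coord \<gamma> \<alpha>"
    then show ?thesis using 0 finite_\<Delta> by (simp add: height_def sum_nonneg_eq_0_iff)
  next
    assume "\<forall>\<alpha>\<in>\<Delta>. coord \<gamma> \<alpha> \<le> 0"
    then show ?thesis using neg finite_\<Delta> by (subst (asm) sum_nonneg_eq_0_iff) auto
  qed
  then have "\<gamma> = 0" using coord_sum[of \<gamma>] by simp
  then show False using assms roots_nz by simp
qed

text \<open>The coordinate of \<beta> at \<open>s\<close> is nonzero, so the multiple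
  \<open>k\<close> is determined by the coordinate at \<open>s\<close> alone.\<close>

lemma \<Psi>_iff:
  "\<gamma> \<in> \<Psi> \<longleftrightarrow> \<gamma> \<in> \<Phi> \<and> level \<gamma> \<in> \<int> \<and> (\<forall>\<alpha>\<in>S. coord \<gamma> \<alpha> = level \<gamma> * coord \<beta> \<alpha>)"
proof -
  have *: "level \<gamma> = k" if "\<forall>\<alpha>\<in>S. coord \<gamma> \<alpha> = k * coord \<beta> \<alpha>" for k
    using bspec[OF that s_in] s_pos by (simp add: level_def)
  show ?thesis
  proof
    assume "\<gamma> \<in> \<Psi>"
    then obtain k :: int where "\<gamma> \<in> \<Phi>" and k: "\<forall>\<alpha>\<in>S. coord \<gamma> \<alpha> = of_int k * coord \<beta> \<alpha>"
      unfolding mult_coord_roots_def by blast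
    then show "\<gamma> \<in> \<Phi> \<and> level \<gamma> \<in> \<int> \<and> (\<forall>\<alpha>\<in>S. coord \<gamma> \<alpha> = level \<gamma> * coord \<beta> \<alpha>)"
      using *[OF k] by simp
  next
    assume "\<gamma> \<in> \<Phi> \<and> level \<gamma> \<in> \<int> \<and> (\<forall>\<alpha>\<in>S. coord \<gamma> \<alpha> = level \<gamma> * coord \<beta> \<alpha>)"
    then show "\<gamma> \<in> \<Psi>" by (auto simp: mult_coord_roots_def elim!: Ints_cases)
  qed
qed

lemma X_iff: "\<gamma> \<in> X \<longleftrightarrow> \<gamma> \<in> \<Psi> \<and> level \<gamma> = 1"
proof -
  have "level \<gamma> = 1" if "\<forall>\<alpha>\<in>S. coord \<gamma> \<alpha> = coord \<beta> \<alpha>"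
    using that s_in s_pos by (simp add: level_def)
  then show ?thesis by (auto simp: \<Psi>_iff same_coord_roots_def)
qed

lemma \<Psi>_subset: "\<Psi> \<subseteq> \<Phi>"
  by (auto simp: \<Psi>_iff)

lemma \<beta>_in_X: "\<beta> \<in> X"
  using \<beta>_root by (simp add: same_coord_roots_def)

lemma finite_X: "finite X"
  using finite_roots by (simp add: same_coord_roots_def)

lemma level_J: "\<alpha> \<in> J \<Longrightarrow> level \<alpha> = 0"
  using s_in by (auto simp: level_def coord_simple)

lemma J_subset: "J \<subseteq> \<Psi>"
proof
  fix \<alpha> assume "\<alpha> \<in> J"
  then show "\<alpha> \<in> \<Psi>" using \<Delta>_subset level_J[of \<alpha>] by (auto simp: \<Psi>_iff coord_simple)
qed

text \<open>By linearity a reflection subtracts a Cartan integer times the level and coordinates of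
  \<alpha>, which keeps the level integral and the \<open>S\<close>-coordinates proportional to
  those of \<beta>. The other axioms are inherited from \<Phi>.\<close>

lemma root_system_\<Psi>: "root_system \<Psi>"
proof -
  have "root_reflection \<alpha> \<gamma> \<in> \<Psi>" if "\<alpha> \<in> \<Psi>" "\<gamma> \<in> \<Psi>" for \<alpha> \<gamma>
  proof -
    have "\<alpha> \<in> \<Phi>" "\<gamma> \<in> \<Phi>" using that \<Psi>_subset by auto
    then have "root_reflection \<alpha> \<gamma> \<in> \<Phi>" and n: "2 * (\<gamma> \<bullet> \<alpha>) / (\<alpha> \<bullet> \<alpha>) \<in> \<int>" (is "?n \<in> \<int>")
      using root_system by (auto simp: root_system_def)
    moreover have "level (root_reflection \<alpha> \<gamma>) = level \<gamma> - ?n * level \<alpha>"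
      by (simp add: root_reflection_def level_simps)
    moreover have "coord (root_reflection \<alpha> \<gamma>) \<delta> = coord \<gamma> \<delta> - ?n * coord \<alpha> \<delta>" for \<delta>
      by (simp add: root_reflection_def coord_simps)
    moreover have "level \<gamma> - ?n * level \<alpha> \<in> \<int>"
      using n that by (intro Ints_diff Ints_mult) (auto simp: \<Psi>_iff)
    ultimately show ?thesis using that
      by (simp add: \<Psi>_iff left_diff_distrib mult.assoc del: times_divide_eq_left)
  qed
  moreover have "finite \<Psi>" "0 \<notin> \<Psi>"
    using finite_subset[OF \<Psi>_subset finite_roots] roots_nz \<Psi>_subset by auto
  moreover have "2 * (\<gamma> \<bullet> \<alpha>) / (\<alpha> \<bullet> \<alpha>) \<in> \<int>" if "\<alpha> \<in> \<Psi>" "\<gamma> \<in> \<Psi>" for \<alpha> \<gamma>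
    using root_system that \<Psi>_subset unfolding root_system_def by (meson subsetD)
  moreover have "c = 1 \<or> c = - 1" if "\<alpha> \<in> \<Psi>" "c *\<^sub>R \<alpha> \<in> \<Psi>" for \<alpha> c
    by (rule root_system_reduced[OF root_system]) (use that \<Psi>_subset in auto)
  ultimately show ?thesis
    unfolding root_system_def by (intro conjI ballI allI impI)
qed

text \<open>One positive coordinate, here at \<open>s\<close>, fixes the sign of all of
  them.\<close>

lemma X_positive: "X \<subseteq> positive_roots \<Phi> \<Delta>"
proof
  fix x assume x: "x \<in> X"
  then have "x \<in> \<Phi>" "coord x s = coord \<beta> s" using s_in by (auto simp: same_coord_roots_def)
  then show "x \<in> positive_roots \<Phi> \<Delta>"
    using s_pos coord_signs[of x] s_simple by (force simp: positive_roots_def)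
qed

lemma root_le_coord:
  assumes "root_le \<Phi> \<Delta> x y" "\<alpha> \<in> \<Delta>"
  shows "coord x \<alpha> \<le> coord y \<alpha>"
proof -
  obtain c where c: "\<forall>\<rho>\<in>positive_roots \<Phi> \<Delta>. 0 \<le> c \<rho>"
    and d: "y - x = (\<Sum>\<rho>\<in>positive_roots \<Phi> \<Delta>. c \<rho> *\<^sub>R \<rho>)"
    using assms(1) by (auto simp: root_le_def)
  have "coord (y - x) \<alpha> = (\<Sum>\<rho>\<in>positive_roots \<Phi> \<Delta>. c \<rho> * coord \<rho> \<alpha>)"
    unfolding d using linear_sum_scaleR[OF linear_coord, of c "\<lambda>x. x"] by simp
  also have "\<dots> \<ge> 0"
    using c assms(2) by (intro sum_nonneg mult_nonneg_nonneg) (auto simp: positive_roots_def)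
  finally show ?thesis by (simp add: coord_simps)
qed

text \<open>The \<open>S\<close>-coordinates of \<gamma> are squeezed between equal values.\<close>

lemma between_in_X:
  assumes "x \<in> X" "y \<in> X" "\<gamma> \<in> \<Phi>" "root_le \<Phi> \<Delta> x \<gamma>" "root_le \<Phi> \<Delta> \<gamma> y"
  shows "\<gamma> \<in> X"
proof -
  have "coord \<gamma> \<alpha> = coord \<beta> \<alpha>" if "\<alpha> \<in> S" for \<alpha>
    using that assms(1,2) S_subset root_le_coord[OF assms(4), of \<alpha>] root_le_coord[OF assms(5), of \<alpha>]
    by (auto simp: same_coord_roots_def)
  then show ?thesis using assms(3) by (simp add: same_coord_roots_def)
qed

text \<open>The elements of \<open>J\<close> are positive roots, so a coefficient family on
  \<open>J\<close> extends by zero to all positive roots.\<close>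

lemma root_leI:
  assumes "\<And>\<alpha>. \<alpha> \<in> J \<Longrightarrow> 0 \<le> c \<alpha>" "y - x = (\<Sum>\<alpha>\<in>J. c \<alpha> *\<^sub>R \<alpha>)"
  shows "root_le \<Phi> \<Delta> x y"
proof -
  have "J \<subseteq> positive_roots \<Phi> \<Delta>"
    using \<Delta>_subset by (auto simp: positive_roots_def coord_simple)
  moreover have "finite (positive_roots \<Phi> \<Delta>)"
    using finite_roots by (simp add: positive_roots_def)
  ultimately have "y - x =
      (\<Sum>\<rho>\<in>positive_roots \<Phi> \<Delta>. (if \<rho> \<in> J then c \<rho> else 0) *\<^sub>R \<rho>)"
    unfolding assms(2) by (intro sum.mono_neutral_cong_left) auto
  then show ?thesis unfolding root_le_def
    using assms(1) by (intro exI[of _ "\<lambda>\<rho>. if \<rho> \<in> J then c \<rho> else 0"]) auto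
qed

text \<open>Subtracting \<open>level \<gamma>\<close> times \<open>m\<close> kills all
  \<open>S\<close>-coordinates and leaves a combination of \<open>J\<close>.\<close>

lemma \<Psi>_subset_span:
  assumes m: "m \<in> X" and \<epsilon>: "\<epsilon> = 1 \<or> \<epsilon> = - 1"
  shows "\<Psi> \<subseteq> span (insert (\<epsilon> *\<^sub>R m) J)"
proof
  fix \<gamma> assume \<gamma>: "\<gamma> \<in> \<Psi>"
  define y where "y = \<gamma> - level \<gamma> *\<^sub>R m"
  have "coord y \<alpha> = 0" if "\<alpha> \<in> S" for \<alpha>
    using \<gamma> m that by (simp add: y_def coord_simps \<Psi>_iff X_iff)
  then have "(\<Sum>\<alpha>\<in>\<Delta>. coord y \<alpha> *\<^sub>R \<alpha>) = (\<Sum>\<alpha>\<in>J. coord y \<alpha> *\<^sub>R \<alpha>)"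
    using finite_\<Delta> by (intro sum.mono_neutral_right) auto
  then have "y = (\<Sum>\<alpha>\<in>J. coord y \<alpha> *\<^sub>R \<alpha>)"
    by (simp only: coord_sum)
  also have "\<dots> \<in> span (insert (\<epsilon> *\<^sub>R m) J)"
    by (intro span_sum span_scale span_base) simp
  finally have "y \<in> span (insert (\<epsilon> *\<^sub>R m) J)" .
  moreover have "(\<epsilon> * level \<gamma>) *\<^sub>R (\<epsilon> *\<^sub>R m) \<in> span (insert (\<epsilon> *\<^sub>R m) J)"
    by (intro span_scale span_base) simp
  ultimately have "y + (\<epsilon> * level \<gamma>) *\<^sub>R (\<epsilon> *\<^sub>R m) \<in> span (insert (\<epsilon> *\<^sub>R m) J)"
    by (rule span_add)
  moreover have "y + (\<epsilon> * level \<gamma>) *\<^sub>R (\<epsilon> *\<^sub>R m) = \<gamma>"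
    using \<epsilon> by (auto simp: y_def)
  ultimately show "\<gamma> \<in> span (insert (\<epsilon> *\<^sub>R m) J)" by simp
qed

text \<open>Stated for any finite set, so that it serves both the whole of \<open>X\<close> and the
  roots of \<open>X\<close> with a given norm.\<close>

lemma ex_extremal:
  assumes "finite Y" "Y \<noteq> {}"
  obtains m where "m \<in> Y" "\<And>x. x \<in> Y \<Longrightarrow> \<epsilon> * height m \<le> \<epsilon> * height x"
proof (rule that)
  show "arg_min_on (\<lambda>x. \<epsilon> * height x) Y \<in> Y" by (rule arg_min_if_finite(1)[OF assms])
  show "\<epsilon> * height (arg_min_on (\<lambda>x. \<epsilon> * height x) Y) \<le> \<epsilon> * height x" if "x \<in> Y" for x
    by (rule arg_min_least[OF assms that])
qed

end

section \<open>Extremal roots of level one, for both signs at once\<close>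

locale extremal_root = coordinate_slice +
  fixes \<epsilon> :: real and m :: 'a
  assumes \<epsilon>: "\<epsilon> = 1 \<or> \<epsilon> = - 1" and m_in: "m \<in> X"
    and m_least: "\<And>x. x \<in> X \<Longrightarrow> \<epsilon> * height m \<le> \<epsilon> * height x"
begin

abbreviation "B \<equiv> insert (\<epsilon> *\<^sub>R m) J"

lemma \<epsilon>_square: "\<epsilon> * \<epsilon> = 1"
  using \<epsilon> by auto

lemma m_in_\<Psi>: "m \<in> \<Psi>" and level_m: "level m = 1"
  using m_in by (auto simp: X_iff)

lemma \<epsilon>_scale_\<Psi>: "\<gamma> \<in> \<Psi> \<Longrightarrow> \<epsilon> *\<^sub>R \<gamma> \<in> \<Psi>"
  using \<epsilon> root_system_uminus[OF root_system_\<Psi>] by auto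

text \<open>The root \<open>\<epsilon> *\<^sub>R x\<close> would again have level 1, but a smaller
  value of \<open>\<epsilon> * height\<close> than \<open>m\<close>, by the amount
  \<open>height y\<close>.\<close>

lemma m_indecomposable:
  assumes xy: "x \<in> \<Psi>" "y \<in> \<Psi>" and eq: "\<epsilon> *\<^sub>R m = x + y"
    and "level y = 0" "height y > 0"
  shows False
proof -
  have "level (\<epsilon> *\<^sub>R x) = 1"
    using arg_cong[OF eq, of level] \<open>level y = 0\<close> \<epsilon>_square by (simp add: level_simps level_m)
  then have "\<epsilon> *\<^sub>R x \<in> X" using \<epsilon>_scale_\<Psi> xy by (simp add: X_iff)
  then have "\<epsilon> * height m \<le> \<epsilon> * height (\<epsilon> *\<^sub>R x)" by (rule m_least)
  also have "\<dots> = height x" using \<epsilon> by (auto simp: height_simps)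
  also have "\<dots> < height (\<epsilon> *\<^sub>R m)" using \<open>height y > 0\<close> by (simp add: eq height_simps)
  finally show False by (simp add: height_simps)
qed

lemma simple_system_B: "simple_system B \<Psi>"
proof -
  \<comment> \<open>\<open>N\<close> exceeds the absolute height of every root. As levels are
    integral on \<Psi>, the sign of \<open>f\<close> there is that of
    \<open>\<epsilon> * level\<close>, and at level 0 that of the height.\<close>
  define N where "N = 1 + (\<Sum>\<gamma>\<in>\<Phi>. \<bar>height \<gamma>\<bar>)"
  define f where "f = (\<lambda>x. height x + N * (\<epsilon> * level x))"
  have N: "\<bar>height \<gamma>\<bar> < N" if "\<gamma> \<in> \<Phi>" for \<gamma>
    using member_le_sum[OF that, of "\<lambda>\<gamma>. \<bar>height \<gamma>\<bar>"] finite_roots by (simp add: N_def)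
  have N0: "N > 0" using N[OF \<beta>_root] by linarith
  have f: "linear f"
    unfolding f_def by (intro linearI) (simp_all add: height_simps level_simps algebra_simps)
  have Ints: "\<epsilon> * level \<gamma> \<in> \<int>" if "\<gamma> \<in> \<Psi>" for \<gamma>
    using that \<epsilon> by (auto simp: \<Psi>_iff)
  have f_gt: "f \<gamma> > 0" if "\<gamma> \<in> \<Psi>" "\<epsilon> * level \<gamma> > 0" for \<gamma>
  proof -
    have "N * 1 \<le> N * (\<epsilon> * level \<gamma>)"
      using Ints_gt_0_ge_1[OF Ints] that N0 by (intro mult_left_mono) auto
    then show ?thesis using N[of \<gamma>] that \<Psi>_subset by (auto simp: f_def)
  qed
  have f_lt: "f \<gamma> < 0" if "\<gamma> \<in> \<Psi>" "\<epsilon> * level \<gamma> < 0" for \<gamma>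
    using f_gt[of "- \<gamma>"] that root_system_uminus[OF root_system_\<Psi>]
    by (simp add: linear_neg[OF f] level_simps)
  have f_0: "f \<gamma> = height \<gamma>" if "\<epsilon> * level \<gamma> = 0" for \<gamma>
    by (simp add: f_def that)
  have level_nonneg: "0 \<le> \<epsilon> * level \<gamma>" if "\<gamma> \<in> \<Psi>" "f \<gamma> > 0" for \<gamma>
    using f_lt[of \<gamma>] that by linarith
  show ?thesis
  proof (rule simple_system_indecomposable[OF root_system_\<Psi> _ _ f])
    show "B \<subseteq> \<Psi>" using J_subset m_in_\<Psi> \<epsilon>_scale_\<Psi> by blast
    show "\<Psi> \<subseteq> span B" by (rule \<Psi>_subset_span[OF m_in \<epsilon>])
    show "f \<gamma> \<noteq> 0" if "\<gamma> \<in> \<Psi>" for \<gamma>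
      using f_gt[OF that] f_lt[OF that] f_0[of \<gamma>] height_nz[of \<gamma>] that \<Psi>_subset
      by (cases "\<epsilon> * level \<gamma>" "0::real" rule: linorder_cases) auto
    show "f b > 0" if "b \<in> B" for b
      using that
    proof
      assume "b = \<epsilon> *\<^sub>R m"
      then show ?thesis using f_gt[of b] m_in_\<Psi> \<epsilon>_scale_\<Psi> \<epsilon>_square
        by (simp add: level_simps level_m)
    next
      assume "b \<in> J"
      then show ?thesis by (simp add: f_0 level_J height_simple)
    qed
    show "b \<noteq> x + y"
      if b: "b \<in> B" and xy: "x \<in> \<Psi>" "y \<in> \<Psi>" "f x > 0" "f y > 0" for b x y
    proof
      assume eq: "b = x + y"
      note nn = level_nonneg[OF xy(1,3)] level_nonneg[OF xy(2,4)]
      have lev: "\<epsilon> * level b = \<epsilon> * level x + \<epsilon> * level y"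
        by (simp add: eq level_simps distrib_left)
      show False using b
      proof
        assume m: "b = \<epsilon> *\<^sub>R m"
        then have 1: "\<epsilon> * level x + \<epsilon> * level y = 1"
          using lev \<epsilon>_square by (simp add: level_simps level_m)
        \<comment> \<open>Two nonnegative integers with sum 1: one is 0, and that summand has
          positive height because \<open>f\<close> is the height at level 0.\<close>
        then have "\<epsilon> * level x = 0 \<or> \<epsilon> * level y = 0"
          using nn Ints_gt_0_ge_1[OF Ints[OF xy(1)]] Ints_gt_0_ge_1[OF Ints[OF xy(2)]] by linarith
        then have "level x = 0 \<or> level y = 0" using \<epsilon> by auto
        then show False
          using m_indecomposable[of x y] m_indecomposable[of y x] xy eq m f_0[of x] f_0[of y]
          by (auto simp: add.commute)
      next
        assume J: "b \<in> J"
        then have "\<epsilon> * level x + \<epsilon> * level y = 0"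
          using lev by (simp only: level_J mult_zero_right)
        \<comment> \<open>Both summands have level 0, so their heights are positive integers,
          whereas a simple root has height 1.\<close>
        then have "\<epsilon> * level x = 0" "\<epsilon> * level y = 0" using nn by linarith+
        then have "height x > 0" "height y > 0" using f_0 xy by auto
        then have "height x \<ge> 1" "height y \<ge> 1"
          using height_Ints xy \<Psi>_subset Ints_gt_0_ge_1 by blast+
        moreover have "height x + height y = 1"
          using J eq height_simple[of b] by (simp add: height_simps)
        ultimately show False by simp
      qed
    qed
  qed
qed

lemma m_notin_J: "\<epsilon> *\<^sub>R m \<notin> J"
proof
  assume "\<epsilon> *\<^sub>R m \<in> J"
  then have "level (\<epsilon> *\<^sub>R m) = 0" by (rule level_J)
  then show False using \<epsilon> by (auto simp: level_simps level_m)
qed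

text \<open>Applying \<open>level\<close>, which vanishes on \<open>J\<close> and equals \<epsilon>
  at \<open>\<epsilon> *\<^sub>R m\<close>, to the expansion isolates the coefficient at
  \<open>\<epsilon> *\<^sub>R m\<close>.\<close>

lemma B_expansion:
  assumes "\<gamma> \<in> \<Psi>"
  shows "\<gamma> = representation B \<gamma> (\<epsilon> *\<^sub>R m) *\<^sub>R (\<epsilon> *\<^sub>R m) + (\<Sum>\<alpha>\<in>J. representation B \<gamma> \<alpha> *\<^sub>R \<alpha>)"
    and "representation B \<gamma> (\<epsilon> *\<^sub>R m) = \<epsilon> * level \<gamma>"
proof -
  have ind: "independent B" and "\<gamma> \<in> span B"
    using simple_system_B assms by (auto simp: simple_system_def span_base)
  then show eq: "\<gamma> = representation B \<gamma> (\<epsilon> *\<^sub>R m) *\<^sub>R (\<epsilon> *\<^sub>R m)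
      + (\<Sum>\<alpha>\<in>J. representation B \<gamma> \<alpha> *\<^sub>R \<alpha>)"
    using sum_representation_eq[OF ind, of \<gamma> B] finite_\<Delta> m_notin_J by simp
  have "level (\<Sum>\<alpha>\<in>J. representation B \<gamma> \<alpha> *\<^sub>R \<alpha>) = 0"
    by (simp add: linear_sum[OF linear_level] level_simps level_J)
  then have "level \<gamma> = representation B \<gamma> (\<epsilon> *\<^sub>R m) * \<epsilon>"
    using arg_cong[OF eq, of level] by (simp add: level_simps level_m)
  then show "representation B \<gamma> (\<epsilon> *\<^sub>R m) = \<epsilon> * level \<gamma>"
    using \<epsilon>_square by (simp add: mult.left_commute)
qed

text \<open>The coefficient of \<open>\<epsilon> *\<^sub>R x\<close> at
  \<open>\<epsilon> *\<^sub>R m\<close> is 1, so the sign condition for the simple system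
  \<open>B\<close> makes the remaining coefficients nonnegative. This puts \<open>m\<close> below
  all of \<open>X\<close> if \<epsilon> is 1, and above if \<epsilon> is -1.\<close>

lemma diff_extremal:
  assumes x: "x \<in> X"
  obtains c where "\<And>\<alpha>. \<alpha> \<in> J \<Longrightarrow> 0 \<le> c \<alpha>" "\<epsilon> *\<^sub>R (x - m) = (\<Sum>\<alpha>\<in>J. c \<alpha> *\<^sub>R \<alpha>)"
proof -
  have ex: "\<epsilon> *\<^sub>R x \<in> \<Psi>" using x \<epsilon>_scale_\<Psi> by (simp add: X_iff)
  define r where "r = representation B (\<epsilon> *\<^sub>R x)"
  have r1: "r (\<epsilon> *\<^sub>R m) = 1"
    using B_expansion(2)[OF ex] x \<epsilon>_square by (simp add: r_def level_simps X_iff)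
  then have "\<forall>b\<in>B. 0 \<le> r b"
    using simple_system_B ex unfolding simple_system_def r_def by force
  moreover have "\<epsilon> *\<^sub>R (x - m) = (\<Sum>\<alpha>\<in>J. r \<alpha> *\<^sub>R \<alpha>)"
    using B_expansion(1)[OF ex] r1 by (simp add: r_def[symmetric] scaleR_diff_right)
  ultimately show ?thesis using that by blast
qed

text \<open>The \<open>B\<close>-coordinate at \<open>\<epsilon> *\<^sub>R m\<close> is
  \<open>\<epsilon> * level\<close>, so it equals 1 exactly when scaling by \<epsilon>, an
  involution of \<Psi>, leads into \<open>X\<close>.\<close>

lemma X_eq: "X = (\<lambda>x. \<epsilon> *\<^sub>R x) ` same_coord_roots \<Psi> B {\<epsilon> *\<^sub>R m} (\<epsilon> *\<^sub>R m)"
proof -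
  have "\<epsilon> *\<^sub>R m \<in> \<Psi>" using m_in_\<Psi> \<epsilon>_scale_\<Psi> by blast
  then have "same_coord_roots \<Psi> B {\<epsilon> *\<^sub>R m} (\<epsilon> *\<^sub>R m) = {\<gamma>\<in>\<Psi>. \<epsilon> * level \<gamma> = 1}"
    using \<epsilon>_square by (auto simp: same_coord_roots_def B_expansion(2) level_simps level_m)
  then have *: "same_coord_roots \<Psi> B {\<epsilon> *\<^sub>R m} (\<epsilon> *\<^sub>R m) = {\<gamma>\<in>\<Psi>. \<epsilon> *\<^sub>R \<gamma> \<in> X}"
    using \<epsilon>_scale_\<Psi> by (auto simp: X_iff level_simps)
  show ?thesis unfolding *
  proof
    show "X \<subseteq> (\<lambda>x. \<epsilon> *\<^sub>R x) ` {\<gamma>\<in>\<Psi>. \<epsilon> *\<^sub>R \<gamma> \<in> X}"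
    proof
      fix x assume "x \<in> X"
      then show "x \<in> (\<lambda>x. \<epsilon> *\<^sub>R x) ` {\<gamma>\<in>\<Psi>. \<epsilon> *\<^sub>R \<gamma> \<in> X}"
        using \<epsilon>_square \<epsilon>_scale_\<Psi> by (intro image_eqI[of _ _ "\<epsilon> *\<^sub>R x"]) (auto simp: X_iff)
    qed
  qed auto
qed

text \<open>An element of its norm class with extremal height is antidominant (up to sign) for \<open>J\<close>.\<close>

lemma inner_J_extremal:
  assumes y: "y \<in> X" and least: "\<And>x. x \<in> X \<Longrightarrow> norm x = norm y \<Longrightarrow> \<epsilon> * height y \<le> \<epsilon> * height x"
    and \<alpha>: "\<alpha> \<in> J"
  shows "\<epsilon> * (y \<bullet> \<alpha>) \<le> 0"
proof (rule ccontr)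
  assume pos: "\<not> \<epsilon> * (y \<bullet> \<alpha>) \<le> 0"
  define n where "n = 2 * (y \<bullet> \<alpha>) / (\<alpha> \<bullet> \<alpha>)"
  \<comment> \<open>The reflection of \<open>y\<close> in \<alpha> keeps level and norm, but lowers
    \<open>\<epsilon> * height\<close> by \<open>\<epsilon> * n\<close>, which is positive under the
    assumption.\<close>
  define z where "z = y - n *\<^sub>R \<alpha>"
  have "\<alpha> \<noteq> 0" using \<alpha> \<Delta>_subset roots_nz by blast
  then have aa: "\<alpha> \<bullet> \<alpha> > 0" by simp
  have z_refl: "z = root_reflection \<alpha> y" by (simp add: z_def n_def root_reflection_def)
  have "z \<in> \<Psi>"
    using root_system_\<Psi> y \<alpha> J_subset unfolding z_refl X_iff root_system_def by blast
  then have "z \<in> X" using y \<alpha> by (simp add: X_iff z_def level_simps level_J)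
  moreover have "norm z = norm y"
  proof -
    have "z \<bullet> z = y \<bullet> y"
      using aa by (simp add: z_def n_def inner_diff_left inner_diff_right inner_commute field_simps)
    then show ?thesis by (simp add: norm_eq_sqrt_inner)
  qed
  ultimately have "\<epsilon> * height y \<le> \<epsilon> * height z" by (rule least)
  also have "\<dots> = \<epsilon> * height y - \<epsilon> * n"
    using \<alpha> by (simp add: z_def height_simps height_simple right_diff_distrib)
  finally have "\<epsilon> * n \<le> 0" by simp
  moreover have "\<epsilon> * n > 0" using pos aa by (simp add: n_def zero_less_divide_iff)
  ultimately show False by simp
qed

text \<open>Let \<open>y\<close> be extremal among the roots of \<open>X\<close> with the norm of
  \<open>x\<close>. Both \<open>y\<close> and \<open>m\<close> pair with \<open>y - m\<close>
  nonpositively, since \<open>\<epsilon> *\<^sub>R (y - m)\<close> is a nonnegative combination of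
  \<open>J\<close>. Hence
  \<open>y \<bullet> y \<le> y \<bullet> m \<le> m \<bullet> m\<close>.\<close>

lemma norm_le_extremal:
  assumes "x \<in> X"
  shows "norm x \<le> norm m"
proof -
  obtain y where y: "y \<in> X" "norm y = norm x"
    and least: "\<And>z. z \<in> X \<Longrightarrow> norm z = norm x \<Longrightarrow> \<epsilon> * height y \<le> \<epsilon> * height z"
  proof (rule ex_extremal)
    show "finite {z\<in>X. norm z = norm x}" using finite_X by simp
    show "{z\<in>X. norm z = norm x} \<noteq> {}" using assms by blast
  qed blast
  obtain c where c: "\<And>\<alpha>. \<alpha> \<in> J \<Longrightarrow> 0 \<le> c \<alpha>" and d: "\<epsilon> *\<^sub>R (y - m) = (\<Sum>\<alpha>\<in>J. c \<alpha> *\<^sub>R \<alpha>)"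
    using diff_extremal[OF y(1)] by blast
  have le: "w \<bullet> (y - m) \<le> 0" if "\<And>\<alpha>. \<alpha> \<in> J \<Longrightarrow> \<epsilon> * (w \<bullet> \<alpha>) \<le> 0" for w
  proof -
    have "w \<bullet> (y - m) = \<epsilon> * (w \<bullet> (\<epsilon> *\<^sub>R (y - m)))"
      using \<epsilon>_square by (simp add: mult.assoc[symmetric])
    also have "\<dots> = (\<Sum>\<alpha>\<in>J. c \<alpha> * (\<epsilon> * (w \<bullet> \<alpha>)))"
      unfolding d inner_sum_right inner_scaleR_right sum_distrib_left
      by (simp add: mult.left_commute)
    also have "\<dots> \<le> 0" by (intro sum_nonpos mult_nonneg_nonpos[OF c that])
    finally show ?thesis .
  qed
  have "y \<bullet> (y - m) \<le> 0"
    using inner_J_extremal[OF y(1)] least y(2) by (intro le) auto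
  moreover have "m \<bullet> (y - m) \<le> 0"
    using inner_J_extremal[OF m_in] m_least by (intro le) auto
  ultimately have "y \<bullet> y \<le> m \<bullet> m"
    by (simp add: inner_diff_right inner_commute)
  then show ?thesis using y(2) by (simp add: norm_eq_sqrt_inner)
qed

end

section \<open>Minimum and maximum from the two signs\<close>

theorem proposition4p2:
  fixes \<Phi> \<Delta> S :: "'a::euclidean_space set" and \<beta> :: 'a
  assumes "root_system \<Phi>" and "span \<Phi> = UNIV" and "irreducible_roots \<Phi>"
    and "simple_system \<Delta> \<Phi>"
    and "S \<subseteq> \<Delta>"
    and "\<beta> \<in> positive_roots \<Phi> \<Delta>"
    and "root_support \<Delta> \<beta> \<inter> S \<noteq> {}"
  shows
    "let X = same_coord_roots \<Phi> \<Delta> S \<beta>;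
         \<Psi> = mult_coord_roots \<Phi> \<Delta> S \<beta>
     in root_subsystem \<Psi> \<Phi> \<and>
        (\<exists>m M.
           X \<subseteq> positive_roots \<Phi> \<Delta> \<and>
           is_root_min \<Phi> \<Delta> X m \<and> is_root_max \<Phi> \<Delta> X M \<and>
           (\<forall>\<gamma>\<in>positive_roots \<Phi> \<Delta>. root_le \<Phi> \<Delta> m \<gamma> \<and> root_le \<Phi> \<Delta> \<gamma> M \<longrightarrow> \<gamma> \<in> X) \<and>
           simple_system ({m} \<union> (\<Delta> - S)) \<Psi> \<and>
           simple_system ({- M} \<union> (\<Delta> - S)) \<Psi> \<and>
           norm m = norm M \<and>
           X = same_coord_roots \<Psi> ({m} \<union> (\<Delta> - S)) {m} m \<and>
           X = uminus ` same_coord_roots \<Psi> ({- M} \<union> (\<Delta> - S)) {- M} (- M))"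
proof -
  obtain s where s: "s \<in> S" "s \<in> \<Delta>" "representation \<Delta> \<beta> s \<noteq> 0"
    using assms(7) by (auto simp: root_support_def)
  then interpret coordinate_slice \<Phi> \<Delta> S \<beta> s
    using assms by unfold_locales (force simp: positive_roots_def)+
  obtain m where "m \<in> X" "\<And>x. x \<in> X \<Longrightarrow> 1 * height m \<le> 1 * height x"
    using ex_extremal[OF finite_X] \<beta>_in_X by blast
  then interpret m: extremal_root \<Phi> \<Delta> S \<beta> s 1 m
    by unfold_locales auto
  obtain M where "M \<in> X" "\<And>x. x \<in> X \<Longrightarrow> - 1 * height M \<le> - 1 * height x"
    using ex_extremal[OF finite_X] \<beta>_in_X by blast
  then interpret M: extremal_root \<Phi> \<Delta> S \<beta> s "- 1" M
    by unfold_locales auto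
  have "root_subsystem \<Psi> \<Phi>"
    using root_system_\<Psi> \<Psi>_subset by (simp add: root_subsystem_def)
  moreover have "is_root_min \<Phi> \<Delta> X m"
    unfolding is_root_min_def
  proof (intro conjI ballI)
    fix x assume "x \<in> X"
    then show "root_le \<Phi> \<Delta> m x" by (rule m.diff_extremal) (auto intro: root_leI)
  qed (rule m.m_in)
  moreover have "is_root_max \<Phi> \<Delta> X M"
    unfolding is_root_max_def
  proof (intro conjI ballI)
    fix x assume "x \<in> X"
    then show "root_le \<Phi> \<Delta> x M" by (rule M.diff_extremal) (auto intro: root_leI)
  qed (rule M.m_in)
  moreover have "\<gamma> \<in> X"
    if "\<gamma> \<in> positive_roots \<Phi> \<Delta>" "root_le \<Phi> \<Delta> m \<gamma>" "root_le \<Phi> \<Delta> \<gamma> M" for \<gamma>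
    using between_in_X[OF m.m_in M.m_in] that by (auto simp: positive_roots_def)
  \<comment> \<open>Each of the two roots has the greatest norm in \<open>X\<close>.\<close>
  moreover have "norm m = norm M"
    using m.norm_le_extremal[OF M.m_in] M.norm_le_extremal[OF m.m_in] by simp
  moreover have "X = same_coord_roots \<Psi> ({m} \<union> J) {m} m"
    using m.X_eq by simp
  moreover have "X = uminus ` same_coord_roots \<Psi> ({- M} \<union> J) {- M} (- M)"
    using M.X_eq by simp
  moreover have "simple_system ({m} \<union> J) \<Psi>" "simple_system ({- M} \<union> J) \<Psi>"
    using m.simple_system_B M.simple_system_B by simp_all
  ultimately show ?thesis
    unfolding Let_def using X_positive by blast
qed

end
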